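(* Let $G=\langle a,t\mid t^2=1,\ atat=tata\rangle$, with generating set $\Sigma=\{a,t\}$ (so $\Sigma\cup\Sigma^{-1}=\{a,a^{-1},t\}$). For any fixed total order on the set $\{a,a^{-1},t\}$, the language of shortlex representatives $\mathrm{SL}_G$ is regular and, therefore, $G$ has finitely many $\mathrm{SL}$-cones with respect to this generating set.
   Context: $\{a,a^{-1},t\}$ is regarded as a subset of $G$ (note $t^{-1}=t$), and $\{a,a^{-1},t\}^*$ is the set of finite words over it; $|w|$ is the length of a word $w$. Shortlex order. For words $w_1,w_2$ over a totally ordered alphabet $(S,<)$: $w_1<_{\mathrm{lex}}w_2$ iff $w_1$ is a strict prefix of $w_2$ or, in the first position where they differ, the letter of $w_1$ is smaller than that of $w_2$; $w_1<_{\mathrm{SL}}w_2$ iff $|w_1|<|w_2|$, or $|w_1|=|w_2|$ and $w_1<_{\mathrm{lex}}w_2$. The order $<_{\mathrm{SL}}$ is a well-ordering. For $g\in G$, $\mathrm{SL}(g)$ is the $<_{\mathrm{SL}}$-minimal word in $\{a,a^{-1},t\}^*$ representing $g$, and $\mathrm{SL}_G=\{\mathrm{SL}(g):g\in G\}$. SL-cones. For $g\in G$, the $\mathrm{SL}$-cone of $g$ is $\mathrm{C}_{\mathrm{SL}}(g)=\{w\in\{a,a^{-1},t\}^*:\ \mathrm{SL}(g)w\in\mathrm{SL}_G\}$, where $\mathrm{SL}(g)w$ is the concatenation of words. "Finitely many $\mathrm{SL}$-cones" means that $\{\mathrm{C}_{\mathrm{SL}}(g):g\in G\}$ is a finite set.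 A language is regular if it is the language accepted by a finite state automaton. *)

theory Defs
  imports "HOL-Algebra.Group"
begin

section \<open>Groups given by generators and relations\<close>

text \<open>A letter \<open>(x, True)\<close> stands for the generator \<open>x\<close>, and \<open>(x, False)\<close> for its formal inverse.\<close>

type_synonym 'x gword = "('x \<times> bool) list"

text \<open>The least congruence on the free monoid over generators and formal inverses that contains
  the free cancellations and the defining relations \<open>u = v\<close>, for \<open>(u, v) \<in> R\<close>.\<close>

inductive pres_eq :: "('x gword \<times> 'x gword) set \<Rightarrow> 'x gword \<Rightarrow> 'x gword \<Rightarrow> bool"
  for R where
  refl: "pres_eq R u u"
| sym: "pres_eq R u v \<Longrightarrow> pres_eq R v u"
| trans: "pres_eq R u v \<Longrightarrow> pres_eq R v w \<Longrightarrow> pres_eq R u w"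
| append: "pres_eq R u u' \<Longrightarrow> pres_eq R v v' \<Longrightarrow> pres_eq R (u @ v) (u' @ v')"
| cancel: "pres_eq R [(x, b), (x, \<not> b)] []"
| rel: "(u, v) \<in> R \<Longrightarrow> pres_eq R u v"

definition pres_class :: "('x gword \<times> 'x gword) set \<Rightarrow> 'x gword \<Rightarrow> 'x gword set" where
  "pres_class R u = {v. pres_eq R u v}"

definition presented_group :: "('x gword \<times> 'x gword) set \<Rightarrow> 'x gword set monoid" where
  "presented_group R =
     \<lparr> carrier = range (pres_class R),
       mult = (\<lambda>X Y. \<Union>u\<in>X. \<Union>v\<in>Y. pres_class R (u @ v)),
       one = pres_class R [] \<rparr>"

definition pres_gen :: "('x gword \<times> 'x gword) set \<Rightarrow> 'x \<Rightarrow> 'x gword set" where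
  "pres_gen R x = pres_class R [(x, True)]"

lemma pres_class_eq_iff: "pres_class R u = pres_class R v \<longleftrightarrow> pres_eq R u v"
  unfolding pres_class_def by (blast intro: pres_eq.refl pres_eq.sym pres_eq.trans)

lemma carrier_presented_group: "carrier (presented_group R) = range (pres_class R)"
  by (simp add: presented_group_def)

lemma one_presented_group: "\<one>\<^bsub>presented_group R\<^esub> = pres_class R []"
  by (simp add: presented_group_def)

lemma mult_presented_group:
  "pres_class R u \<otimes>\<^bsub>presented_group R\<^esub> pres_class R v = pres_class R (u @ v)"
  unfolding presented_group_def pres_class_def
  by (auto intro: pres_eq.refl pres_eq.append pres_eq.trans)

lemma pres_eq_inverse: "pres_eq R (rev (map (\<lambda>(x, b). (x, \<not> b)) u) @ u) []"
proof (induction u)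
  case Nil
  show ?case by (simp add: pres_eq.refl)
next
  case (Cons p u)
  obtain x b where p: "p = (x, b)" by (cases p)
  let ?v = "rev (map (\<lambda>(x, b). (x, \<not> b)) u)"
  have "pres_eq R ([(x, \<not> b), (x, b)] @ u) ([] @ u)"
    using pres_eq.append[OF pres_eq.cancel[of R x "\<not> b"] pres_eq.refl[of R u]]
    by (simp only: not_not)
  then have "pres_eq R (?v @ ([(x, \<not> b), (x, b)] @ u)) (?v @ ([] @ u))"
    by (rule pres_eq.append[OF pres_eq.refl])
  then show ?case
    using Cons.IH by (auto simp: p intro: pres_eq.trans)
qed

lemma group_presented_group: "group (presented_group R)"
proof (rule groupI)
  fix X assume "X \<in> carrier (presented_group R)"
  then obtain u where u: "X = pres_class R u"
    by (auto simp: carrier_presented_group)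
  show "\<exists>Y\<in>carrier (presented_group R). Y \<otimes>\<^bsub>presented_group R\<^esub> X = \<one>\<^bsub>presented_group R\<^esub>"
    using pres_eq_inverse[of R u]
    by (auto simp: u carrier_presented_group one_presented_group mult_presented_group
        pres_class_eq_iff)
qed (auto simp: carrier_presented_group one_presented_group mult_presented_group)

text \<open>The universal property, as a check on the construction.\<close>

definition gword_val :: "('g, 'm) monoid_scheme \<Rightarrow> ('x \<Rightarrow> 'g) \<Rightarrow> 'x gword \<Rightarrow> 'g" where
  "gword_val H f u =
     foldr (\<otimes>\<^bsub>H\<^esub>) (map (\<lambda>(x, b). if b then f x else inv\<^bsub>H\<^esub> f x) u) \<one>\<^bsub>H\<^esub>"

lemma presented_group_universal:
  assumes H: "group H" and f: "\<And>x. f x \<in> carrier H"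
    and R: "\<And>u v. (u, v) \<in> R \<Longrightarrow> gword_val H f u = gword_val H f v"
  shows "\<exists>h \<in> hom (presented_group R) H. \<forall>x. h (pres_gen R x) = f x"
proof -
  interpret H: group H by (rule H)
  have closed: "gword_val H f u \<in> carrier H" for u
    by (induction u) (auto simp: gword_val_def f)
  have app: "gword_val H f (u @ v) = gword_val H f u \<otimes>\<^bsub>H\<^esub> gword_val H f v" for u v
  proof (induction u)
    case Nil
    show ?case using closed[of v] by (simp add: gword_val_def)
  next
    case (Cons p u)
    obtain x b where p: "p = (x, b)" by (cases p)
    have "gword_val H f (p # w) = (if b then f x else inv\<^bsub>H\<^esub> f x) \<otimes>\<^bsub>H\<^esub> gword_val H f w" for w
      by (simp add: gword_val_def p)
    then show ?case
      using Cons closed f by (simp add: H.m_assoc)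
  qed
  have eq: "gword_val H f u = gword_val H f v" if "pres_eq R u v" for u v
    using that
  proof induction
    case (cancel x b)
    show ?case by (cases b) (simp_all add: gword_val_def f)
  qed (auto simp: app R)
  define h where "h X = gword_val H f (SOME u. u \<in> X)" for X
  have h: "h (pres_class R u) = gword_val H f u" for u
  proof -
    have "(SOME v. v \<in> pres_class R u) \<in> pres_class R u"
      by (rule someI[of _ u]) (simp add: pres_class_def pres_eq.refl)
    then show ?thesis
      using eq by (auto simp: h_def pres_class_def)
  qed
  have "h \<in> hom (presented_group R) H"
    by (rule homI) (auto simp: carrier_presented_group h mult_presented_group closed app)
  moreover have "h (pres_gen R x) = f x" for x
    using f by (simp add: pres_gen_def h gword_val_def)
  ultimately show ?thesis by blast
qed


section \<open>Shortlex representatives and SL-cones\<close>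

text \<open>In the following, \<open>S\<close> is a set of group elements serving as alphabet, words are
  elements of \<^term>\<open>lists S\<close>, and \<open>lt\<close> is a strict total order on \<open>S\<close>.\<close>

definition word_val :: "('g, 'm) monoid_scheme \<Rightarrow> 'g list \<Rightarrow> 'g" where
  "word_val G w = foldr (\<otimes>\<^bsub>G\<^esub>) w \<one>\<^bsub>G\<^esub>"

definition shortlex :: "('s \<times> 's) set \<Rightarrow> ('s list \<times> 's list) set" where
  "shortlex lt = {(u, v). length u < length v \<or> length u = length v \<and> (u, v) \<in> lexord lt}"

lemma shortlex_eq_lenlex: "shortlex lt = lenlex lt"
  by (auto simp: shortlex_def lenlex_conv lexord_lex)

definition SL :: "('g, 'm) monoid_scheme \<Rightarrow> 'g set \<Rightarrow> ('g \<times> 'g) set \<Rightarrow> 'g \<Rightarrow> 'g list" where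
  "SL G S lt g =
     (THE w. w \<in> lists S \<and> word_val G w = g \<and>
        (\<forall>v \<in> lists S. word_val G v = g \<longrightarrow> v \<noteq> w \<longrightarrow> (w, v) \<in> shortlex lt))"

definition SL_language :: "('g, 'm) monoid_scheme \<Rightarrow> 'g set \<Rightarrow> ('g \<times> 'g) set \<Rightarrow> 'g list set" where
  "SL_language G S lt = SL G S lt ` carrier G"

definition SL_cone ::
  "('g, 'm) monoid_scheme \<Rightarrow> 'g set \<Rightarrow> ('g \<times> 'g) set \<Rightarrow> 'g \<Rightarrow> 'g list set" where
  "SL_cone G S lt g = {w \<in> lists S. SL G S lt g @ w \<in> SL_language G S lt}"

text \<open>The description in \<^const>\<open>SL\<close> is proper for every element represented by some word.\<close>

lemma SL_minimal:
  assumes "finite S" and lt: "strict_linear_order_on S lt" "lt \<subseteq> S \<times> S"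
    and u: "u \<in> lists S" "word_val G u = g"
  shows "SL G S lt g \<in> lists S" and "word_val G (SL G S lt g) = g"
    and "\<And>v. v \<in> lists S \<Longrightarrow> word_val G v = g \<Longrightarrow> v \<noteq> SL G S lt g \<Longrightarrow>
           (SL G S lt g, v) \<in> shortlex lt"
proof -
  have "finite lt"
    using assms by (meson finite_SigmaI finite_subset)
  moreover have "acyclic lt"
    using lt by (simp add: strict_linear_order_on_def acyclic_irrefl)
  ultimately have wf: "wf (shortlex lt)"
    by (simp add: finite_acyclic_wf shortlex_eq_lenlex wf_lenlex)
  have total: "(x, y) \<in> lexord lt \<or> (y, x) \<in> lexord lt"
    if "x \<in> lists S" "y \<in> lists S" "x \<noteq> y" for x y
    using that
  proof (induction x arbitrary: y)
    case Nil
    then show ?case by (cases y) auto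
  next
    case (Cons a x)
    then show ?case
      using lt by (cases y) (auto simp: strict_linear_order_on_def total_on_def)
  qed
  let ?W = "{w \<in> lists S. word_val G w = g}"
  let ?P = "\<lambda>w. w \<in> lists S \<and> word_val G w = g \<and>
    (\<forall>v \<in> lists S. word_val G v = g \<longrightarrow> v \<noteq> w \<longrightarrow> (w, v) \<in> shortlex lt)"
  obtain w where w: "w \<in> ?W" "\<And>v. (v, w) \<in> shortlex lt \<Longrightarrow> v \<notin> ?W"
    using wfE_min[OF wf, of u ?W] u by blast
  have "(w, v) \<in> shortlex lt" if "v \<in> lists S" "word_val G v = g" "v \<noteq> w" for v
  proof -
    have "(v, w) \<in> shortlex lt \<or> (w, v) \<in> shortlex lt"
      using total[of v w] w(1) that by (auto simp: shortlex_def)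
    then show ?thesis
      using w(2) that by blast
  qed
  then have P: "?P w"
    using w(1) by blast
  moreover have "v = w" if "?P v" for v
    using that P wf_not_sym[OF wf] by blast
  ultimately have "?P (SL G S lt g)"
    unfolding SL_def by (rule theI[of ?P])
  then show "SL G S lt g \<in> lists S" "word_val G (SL G S lt g) = g"
    "\<And>v. v \<in> lists S \<Longrightarrow> word_val G v = g \<Longrightarrow> v \<noteq> SL G S lt g \<Longrightarrow>
       (SL G S lt g, v) \<in> shortlex lt"
    by blast+
qed


section \<open>Regular languages\<close>

text \<open>Acceptance by a complete deterministic automaton. States are natural numbers; this is no
  restriction since the state set is finite, see \<open>regular_languageI\<close>.\<close>

definition regular_language :: "'s set \<Rightarrow> 's list set \<Rightarrow> bool" where
  "regular_language S L \<longleftrightarrow>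
     (\<exists>(Q :: nat set) q0 \<delta> F. finite Q \<and> q0 \<in> Q \<and> (\<forall>q\<in>Q. \<forall>s\<in>S. \<delta> q s \<in> Q) \<and> F \<subseteq> Q \<and>
        L = {w \<in> lists S. foldl \<delta> q0 w \<in> F})"

lemma regular_languageI:
  fixes Q :: "'q set"
  assumes Q: "finite Q" "q0 \<in> Q" "\<And>q s. q \<in> Q \<Longrightarrow> s \<in> S \<Longrightarrow> \<delta> q s \<in> Q" "F \<subseteq> Q"
    and L: "L = {w \<in> lists S. foldl \<delta> q0 w \<in> F}"
  shows "regular_language S L"
proof -
  obtain e :: "'q \<Rightarrow> nat" where e: "inj_on e Q"
    using finite_imp_inj_to_nat_seg[OF Q(1)] by blast
  define d where "d = inv_into Q e"
  have de: "d (e q) = q" if "q \<in> Q" for q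
    using e that by (simp add: d_def)
  define \<delta>' where "\<delta>' n s = e (\<delta> (d n) s)" for n s
  have run: "foldl \<delta> q w \<in> Q \<and> foldl \<delta>' (e q) w = e (foldl \<delta> q w)"
    if "q \<in> Q" "w \<in> lists S" for q w
    using that by (induction w arbitrary: q) (auto simp: \<delta>'_def de Q)
  have mem: "e q \<in> e ` F \<longleftrightarrow> q \<in> F" if "q \<in> Q" for q
    using e that Q(4) by (auto dest: inj_onD)
  have "L = {w \<in> lists S. foldl \<delta>' (e q0) w \<in> e ` F}"
    unfolding L
  proof (rule Collect_cong, rule conj_cong)
    fix w assume "w \<in> lists S"
    then show "foldl \<delta> q0 w \<in> F \<longleftrightarrow> foldl \<delta>' (e q0) w \<in> e ` F"
      using run[OF Q(2)] mem by simp
  qed simp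
  moreover have "\<forall>n\<in>e ` Q. \<forall>s\<in>S. \<delta>' n s \<in> e ` Q"
    by (auto simp: \<delta>'_def de Q)
  ultimately show ?thesis
    unfolding regular_language_def using Q
    by (intro exI[of _ "e ` Q"] exI[of _ "e q0"] exI[of _ \<delta>'] exI[of _ "e ` F"]) auto
qed


section \<open>The group with presentation \<open>\<langle>a, t | t\<^sup>2 = 1, atat = tata\<rangle>\<close>\<close>

datatype gen = gen_a | gen_t

definition G_rels :: "(gen gword \<times> gen gword) set" where
  "G_rels =
     (let a = (gen_a, True); t = (gen_t, True)
      in {([t, t], []), ([a, t, a, t], [t, a, t, a])})"

definition G_at :: "gen gword set monoid" where
  "G_at = presented_group G_rels"

definition elt_a :: "gen gword set" where
  "elt_a = pres_gen G_rels gen_a"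

definition elt_t :: "gen gword set" where
  "elt_t = pres_gen G_rels gen_t"

text \<open>The alphabet \<open>\<Sigma> \<union> \<Sigma>\<^sup>-\<^sup>1\<close>, where \<open>t\<^sup>-\<^sup>1 = t\<close>.\<close>

definition G_alphabet :: "gen gword set set" where
  "G_alphabet = {elt_a, inv\<^bsub>G_at\<^esub> elt_a, elt_t}"

end

theory Submission
  imports Defs
begin

text \<open>The relation \<open>atat = tata\<close> says that \<open>a\<close> commutes with its conjugate \<open>tat\<close>, so \<open>G\<close> is the
  wreath product of the integers with the group of order two. Hence every element is represented
  by a word \<open>a\<^sup>m\<close>, \<open>a\<^sup>m t a\<^sup>n\<close> or \<open>a\<^sup>m t a\<^sup>n t a\<^sup>k\<close> with \<open>n \<noteq> 0\<close>. In the last case only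
  \<open>m + k\<close> is determined, and the shortlex representative has \<open>k = 0\<close> or \<open>m = 0\<close> according to
  whether the letter of \<open>a\<^sup>m\<^sup>+\<^sup>k\<close> precedes \<open>t\<close>. A finite automaton recognises this by storing
  the signs of the exponents. Any other word has a prefix that a single rewriting step makes smaller
  in the shortlex order.\<close>

section \<open>Regular languages have finitely many residuals\<close>

text \<open>The residual of \<open>u\<close> depends only on the state that \<open>u\<close> leads
  to from \<open>q0\<close>, so there are at most as many residuals as states.\<close>

lemma regular_language_finite_residuals:
  assumes "regular_language S L"
  shows "finite ((\<lambda>u. {w \<in> lists S. u @ w \<in> L}) ` lists S)"
proof -
  obtain Q :: "nat set" and q0 \<delta> F where Q: "finite Q" "q0 \<in> Q" "\<forall>q\<in>Q. \<forall>s\<in>S. \<delta> q s \<in> Q"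
    and L: "L = {w \<in> lists S. foldl \<delta> q0 w \<in> F}"
    using assms unfolding regular_language_def by blast
  have "foldl \<delta> q w \<in> Q" if "q \<in> Q" "w \<in> lists S" for q w
    using that Q(3) by (induction w arbitrary: q) auto
  then have "(\<lambda>u. {w \<in> lists S. u @ w \<in> L}) ` lists S
      \<subseteq> (\<lambda>q. {w \<in> lists S. foldl \<delta> q w \<in> F}) ` Q"
    using Q(2) by (auto simp: L)
  then show ?thesis
    using Q(1) by (meson finite_imageI finite_subset)
qed


section \<open>The wreath product of the integers with the group of order two\<close>

text \<open>The triple \<open>(m, n, e)\<close> stands for \<open>a^m (t a^n t) t^e\<close>; moving
  \<open>t\<close> to the right past such an element swaps its two exponents.\<close>

fun wreath_mult :: "int \<times> int \<times> bool \<Rightarrow> int \<times> int \<times> bool \<Rightarrow> int \<times> int \<times> bool" where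
  "wreath_mult (m, n, e) (m', n', e') =
     (if e then (m + n', n + m', \<not> e') else (m + m', n + n', e'))"

definition wreath :: "(int \<times> int \<times> bool) monoid" where
  "wreath = \<lparr>carrier = UNIV, mult = wreath_mult, one = (0, 0, False)\<rparr>"

lemma wreath_simps [simp]:
  "carrier wreath = UNIV" "mult wreath = wreath_mult" "one wreath = (0, 0, False)"
  by (simp_all add: wreath_def)

lemma group_wreath: "group wreath"
proof (rule groupI)
  fix x assume "x \<in> carrier wreath"
  obtain m n e where x: "x = (m, n, e)" by (cases x)
  \<comment> \<open>For odd parity, inversion also swaps the exponents.\<close>
  have "wreath_mult (if e then (-n, -m, e) else (-m, -n, e)) x = (0, 0, False)"
    by (simp add: x)
  then show "\<exists>y\<in>carrier wreath. y \<otimes>\<^bsub>wreath\<^esub> x = \<one>\<^bsub>wreath\<^esub>"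
    by (metis UNIV_I wreath_simps)
qed auto

lemma wreath_int_pow: "(1, 0, False) [^]\<^bsub>wreath\<^esub> (m::int) = (m, 0, False)"
proof -
  interpret group wreath by (rule group_wreath)
  have nat: "(1, 0, False) [^]\<^bsub>wreath\<^esub> (n::nat) = (int n, 0, False)" for n
    by (induction n) auto
  have inv: "inv\<^bsub>wreath\<^esub> (int n, 0, False) = (- int n, 0, False)" for n
    by (rule inv_equality) auto
  show ?thesis
    by (cases m rule: int_cases2) (simp_all add: int_pow_int int_pow_neg_int nat inv)
qed


section \<open>Shortlex representatives in a copy of the wreath product\<close>

text \<open>The first three constructors stand for zero, one or two \<open>T\<close>s read.
  \<open>Post\<close> keeps the first and third exponents; the middle one is then closed and known
  to be nonzero.\<close>

datatype state = Pre int | Mid int int | Post int int | Sink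

text \<open>An injective homomorphism turns equality in the group into equality of integer triples;
  surjectivity follows later from explicit words.\<close>

locale wreath_copy = group G for G (structure) +
  fixes A T :: 'a and h :: "'a \<Rightarrow> int \<times> int \<times> bool" and lt :: "('a \<times> 'a) set"
  assumes A [simp]: "A \<in> carrier G" and T [simp]: "T \<in> carrier G"
    and hom_h: "h \<in> hom G wreath" and inj_h: "inj_on h (carrier G)"
    and h_A [simp]: "h A = (1, 0, False)" and h_T [simp]: "h T = (0, 0, True)"
    and lt_sub: "lt \<subseteq> {A, inv A, T} \<times> {A, inv A, T}"
    and lt_lin: "strict_linear_order_on {A, inv A, T} lt"
begin

abbreviation S where "S \<equiv> {A, inv A, T}"

section \<open>Coordinates of words and powers of \<open>A\<close>\<close>

definition coord :: "'a list \<Rightarrow> int \<times> int \<times> bool" where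
  "coord w = h (word_val G w)"

text \<open>The default at 0 is harmless: \<open>apow 0\<close> is empty, and letters are compared
  with \<open>T\<close> only for nonzero exponents.\<close>

definition letter :: "int \<Rightarrow> 'a" where
  "letter s = (if 0 < s then A else inv A)"

definition apow :: "int \<Rightarrow> 'a list" where
  "apow m = replicate (nat \<bar>m\<bar>) (letter m)"

definition reducible :: "'a list \<Rightarrow> bool" where
  "reducible w \<longleftrightarrow> (\<exists>v \<in> lists S. coord v = coord w \<and> (v, w) \<in> shortlex lt)"

lemma h_mult [simp]:
  "x \<in> carrier G \<Longrightarrow> y \<in> carrier G \<Longrightarrow> h (x \<otimes> y) = wreath_mult (h x) (h y)"
  using hom_mult[OF hom_h] by simp

lemma h_one [simp]: "h \<one> = (0, 0, False)"
  using hom_one[OF hom_h is_group group_wreath] by simp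

lemma h_inv_A [simp]: "h (inv A) = (-1, 0, False)"
proof -
  obtain m n e where e: "h (inv A) = (m, n, e)" by (cases "h (inv A)")
  have "wreath_mult (h A) (h (inv A)) = (0, 0, False)"
    by (metis A h_mult h_one inv_closed r_inv)
  then show ?thesis by (auto simp: e)
qed

lemma letters_distinct [simp]: "T \<noteq> A" "A \<noteq> T" "T \<noteq> inv A" "inv A \<noteq> T" "inv A \<noteq> A" "A \<noteq> inv A"
  by (metis h_A h_T h_inv_A prod.inject zero_neq_one one_neq_neg_one zero_neq_neg_one)+

lemma letter_simps [simp]: "letter s \<in> S" "letter s \<noteq> T" "T \<noteq> letter s"
  by (auto simp: letter_def)

lemma letter_cases [simp]: "letter s = A \<or> letter s = inv A"
  by (auto simp: letter_def)

lemma h_letter: "s \<in> {-1, 1} \<Longrightarrow> h (letter s) = (s, 0, False)"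
  by (auto simp: letter_def)

lemma word_val_closed [simp]: "w \<in> lists S \<Longrightarrow> word_val G w \<in> carrier G"
  by (induction w) (auto simp: word_val_def)

lemma coord_Nil [simp]: "coord [] = (0, 0, False)"
  by (simp add: coord_def word_val_def)

lemma coord_Cons: "x \<in> S \<Longrightarrow> w \<in> lists S \<Longrightarrow> coord (x # w) = wreath_mult (h x) (coord w)"
  using word_val_closed[of w] by (auto simp: coord_def word_val_def)

lemma wreath_mult_assoc: "wreath_mult (wreath_mult x y) z = wreath_mult x (wreath_mult y z)"
  by (cases x; cases y; cases z) auto

lemma coord_append:
  "u \<in> lists S \<Longrightarrow> v \<in> lists S \<Longrightarrow> coord (u @ v) = wreath_mult (coord u) (coord v)"
proof (induction u)
  case Nil
  then show ?case by (cases "coord v") simp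
next
  case (Cons x u)
  then have "coord (x # (u @ v)) = wreath_mult (h x) (coord (u @ v))"
    by (intro coord_Cons) auto
  moreover have "coord (x # u) = wreath_mult (h x) (coord u)"
    using Cons.prems by (intro coord_Cons) auto
  ultimately show ?case
    using Cons by (simp add: wreath_mult_assoc)
qed

lemma coord_eq_iff:
  "u \<in> lists S \<Longrightarrow> v \<in> lists S \<Longrightarrow> coord u = coord v \<longleftrightarrow> word_val G u = word_val G v"
  unfolding coord_def by (rule inj_on_eq_iff[OF inj_h]) (rule word_val_closed, assumption)+

lemma apow_lists [simp]: "apow m \<in> lists S"
  using letter_cases[of m] by (auto simp: apow_def simp del: letter_cases)

lemma apow_set: "x \<in> set (apow m) \<Longrightarrow> x \<in> S"
  using apow_lists[of m] by (auto simp del: apow_lists)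

lemma apow_0 [simp]: "apow 0 = []"
  by (simp add: apow_def)

lemma length_apow [simp]: "length (apow m) = nat \<bar>m\<bar>"
  by (simp add: apow_def)

lemma apow_Cons: "m \<noteq> 0 \<Longrightarrow> apow m = letter (sgn m) # apow (m - sgn m)"
proof -
  assume m: "m \<noteq> 0"
  then have "nat \<bar>m\<bar> = Suc (nat \<bar>m - sgn m\<bar>)" by (auto simp: sgn_if)
  \<comment> \<open>At \<open>m = sgn m\<close> the letter falls to its default, but then nothing is
    left to replicate.\<close>
  moreover have "letter (m - sgn m) = letter m \<or> nat \<bar>m - sgn m\<bar> = 0"
    using m by (auto simp: letter_def sgn_if)
  moreover have "letter m = letter (sgn m)"
    using m by (auto simp: letter_def sgn_if)
  ultimately show ?thesis by (auto simp: apow_def)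
qed

lemma coord_apow [simp]: "coord (apow m) = (m, 0, False)"
proof (induction "nat \<bar>m\<bar>" arbitrary: m)
  case 0
  then show ?case by simp
next
  case (Suc k)
  then have m: "m \<noteq> 0" "k = nat \<bar>m - sgn m\<bar>" by (auto simp: sgn_if)
  have "coord (apow m) = wreath_mult (h (letter (sgn m))) (coord (apow (m - sgn m)))"
    by (metis apow_Cons[OF m(1)] coord_Cons letter_simps(1) apow_lists)
  also have "\<dots> = (m, 0, False)"
    using m Suc(1)[OF m(2)] by (subst h_letter) (auto simp: sgn_if)
  finally show ?case .
qed

lemma coord_letter: "s \<in> {-1, 1} \<Longrightarrow> coord [letter s] = (s, 0, False)"
  by (auto simp: coord_def word_val_def letter_def)

lemma coord_T [simp]: "coord [T] = (0, 0, True)"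
  by (simp add: coord_def word_val_def)

lemma coord_T_Cons: "w \<in> lists S \<Longrightarrow> coord (T # w) = wreath_mult (0, 0, True) (coord w)"
  by (simp add: coord_Cons)

lemma apow_snoc:
  assumes "s \<in> {-1, 1}" "sgn m \<noteq> -s"
  shows "apow m @ [letter s] = apow (m + s)"
proof -
  have "nat \<bar>m + s\<bar> = Suc (nat \<bar>m\<bar>)" "letter (m + s) = letter s"
    "nat \<bar>m\<bar> = 0 \<or> letter m = letter s"
    using assms by (auto simp: sgn_if letter_def split: if_splits)
  then show ?thesis
    by (auto simp: apow_def replicate_append_same)
qed

lemmas coord_simps = coord_append coord_T_Cons coord_letter apow_set

section \<open>Reducible words and free cancellation\<close>

lemma reducibleI:
  "v \<in> lists S \<Longrightarrow> coord v = coord w \<Longrightarrow> length v < length w \<Longrightarrow> reducible w"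
  by (auto simp: reducible_def shortlex_def)

lemma reducibleI_lex:
  "v \<in> lists S \<Longrightarrow> coord v = coord w \<Longrightarrow> length v = length w \<Longrightarrow> (v, w) \<in> lexord lt \<Longrightarrow> reducible w"
  by (auto simp: reducible_def shortlex_def)

text \<open>Shortlex is compatible with concatenation on both sides, so a smaller equivalent of one
  factor yields one of the whole word.\<close>

lemma reducible_append:
  assumes "reducible w" "w \<in> lists S" "u \<in> lists S" "v \<in> lists S"
  shows "reducible (u @ w @ v)"
proof -
  obtain w' where w': "w' \<in> lists S" "coord w' = coord w" "(w', w) \<in> shortlex lt"
    using assms(1) by (auto simp: reducible_def)
  have "(u @ w' @ v, u @ w @ v) \<in> shortlex lt"
    \<comment> \<open>Equal lengths rule out a proper prefix, so the first difference survives
      appending \<open>v\<close>.\<close>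
    using w'(3) lexord_append_leftI[OF lexord_sufI[of w' w lt v v], of u]
    by (auto simp: shortlex_def)
  moreover have "coord (u @ w' @ v) = coord (u @ w @ v)"
    using w'(1,2) assms by (simp add: coord_append)
  moreover have "u @ w' @ v \<in> lists S"
    using w'(1) assms by simp
  ultimately show ?thesis
    unfolding reducible_def by blast
qed

text \<open>The new letter is inverse to the last letter of the block, so
  \<open>apow (m + s)\<close> is shorter.\<close>

lemma reducible_cancel:
  assumes "s \<in> {-1, 1}" "sgn m = -s" "u \<in> lists S"
  shows "reducible (u @ apow m @ [letter s])"
proof -
  have "reducible (apow m @ [letter s])"
    using assms by (intro reducibleI[of "apow (m + s)"])
      (auto simp: coord_simps sgn_if split: if_splits)
  from reducible_append[OF this _ assms(3), of "[]"] show ?thesis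
    using letter_simps(1)[of s] by simp
qed

definition sign :: "'a \<Rightarrow> int" where
  "sign x = (if x = A then 1 else -1)"

lemma sign: "sign x \<in> {-1, 1}"
  by (simp add: sign_def)

lemma letter_sign: "x \<in> S \<Longrightarrow> x \<noteq> T \<Longrightarrow> letter (sign x) = x"
  by (auto simp: sign_def letter_def)

text \<open>Branches into \<open>Sink\<close> are free cancellation, \<open>TT\<close>, a third
  \<open>T\<close>, and breaches of the rule that places an outer exponent before or after the
  middle block. Signs suffice because a letter either extends or cancels the current block.
  \<open>sign T\<close> is a default and never decides a branch.\<close>

fun step :: "state \<Rightarrow> 'a \<Rightarrow> state" where
  "step (Pre i) x =
     (if x = T then Mid i 0 else if i = - sign x then Sink else Pre (sign x))"
| "step (Mid i j) x =
     (if x = T then (if j \<noteq> 0 \<and> (i \<noteq> 0 \<longrightarrow> (letter i, T) \<in> lt) then Post i 0 else Sink)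
      else if j = - sign x then Sink else Mid i (sign x))"
| "step (Post i k) x =
     (if x = T \<or> i \<noteq> 0 \<or> k = - sign x \<or> (x, T) \<in> lt then Sink else Post 0 (sign x))"
| "step Sink x = Sink"

text \<open>The integers in a state are the signs of the exponents read so far.\<close>

fun state_inv :: "'a list \<Rightarrow> state \<Rightarrow> bool" where
  "state_inv w (Pre i) \<longleftrightarrow> (\<exists>m. w = apow m \<and> i = sgn m)"
| "state_inv w (Mid i j) \<longleftrightarrow> (\<exists>m n. w = apow m @ T # apow n \<and> i = sgn m \<and> j = sgn n)"
| "state_inv w (Post i l) \<longleftrightarrow> (\<exists>m n k. w = apow m @ T # apow n @ T # apow k
     \<and> i = sgn m \<and> l = sgn k \<and> n \<noteq> 0 \<and> (m = 0 \<or> k = 0) \<and>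
     (m \<noteq> 0 \<longrightarrow> (letter (sgn m), T) \<in> lt) \<and> (k \<noteq> 0 \<longrightarrow> (letter (sgn k), T) \<notin> lt))"
| "state_inv w Sink \<longleftrightarrow> reducible w"

section \<open>Rewriting steps behind the transitions into \<open>Sink\<close>\<close>

lemma lt_cases: "x \<in> S \<Longrightarrow> y \<in> S \<Longrightarrow> x \<noteq> y \<Longrightarrow> (x, y) \<notin> lt \<Longrightarrow> (y, x) \<in> lt"
  using lt_lin unfolding strict_linear_order_on_def total_on_def by blast

lemma reducible_double_T: "reducible (apow m @ T # apow 0 @ [T])"
  by (intro reducibleI[of "apow m"]) (auto simp: coord_simps)

text \<open>The block \<open>T a^n T\<close> commutes with powers of \<open>A\<close>. Putting it
  first keeps the length and starts the word with \<open>T\<close>, which precedes the old first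
  letter.\<close>

lemma reducible_move_left:
  assumes "m \<noteq> 0" "(letter (sgn m), T) \<notin> lt"
  shows "reducible (apow m @ T # apow n @ [T])"
proof (rule reducibleI_lex)
  have "(T, letter (sgn m)) \<in> lt"
    using assms lt_cases[OF letter_simps(1)] by auto
  then show "(T # apow n @ T # apow m, apow m @ T # apow n @ [T]) \<in> lexord lt"
    by (simp add: apow_Cons[OF assms(1)])
qed (auto simp: coord_simps)

text \<open>Moving \<open>apow k\<close> left across the commuting block merges it with
  \<open>apow m\<close> and lets the last two \<open>T\<close>s cancel.\<close>

lemma reducible_three_T: "reducible (apow m @ T # apow n @ T # apow k @ [T])"
  by (intro reducibleI[of "apow (m + k) @ T # apow n"]) (auto simp: coord_simps)

text \<open>The last letter moves across the commuting block into the first one. There it either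
  cancels, which shortens the word, or takes the place of a \<open>T\<close> that it
  precedes.\<close>

lemma reducible_move_right:
  assumes s: "s \<in> {-1, 1}" and "m \<noteq> 0 \<and> sgn m = - s \<or> (letter s, T) \<in> lt"
  shows "reducible (apow m @ T # apow n @ T # [letter s])"
proof (cases "sgn m = - s")
  case True
  then show ?thesis
    using s letter_simps(1)[of s] by (intro reducibleI[of "apow (m + s) @ T # apow n @ [T]"])
      (auto simp: coord_simps sgn_if split: if_splits)
next
  case False
  then have eq: "apow (m + s) = apow m @ [letter s]"
    using apow_snoc[OF s] by simp
  have lt: "(letter s, T) \<in> lt"
    using assms False by auto
  show ?thesis
  proof (rule reducibleI_lex)
    show "(apow (m + s) @ T # apow n @ [T], apow m @ T # apow n @ T # [letter s]) \<in> lexord lt"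
      using lt by (simp add: eq lexord_append_leftI)
    show "length (apow (m + s) @ T # apow n @ [T]) = length (apow m @ T # apow n @ T # [letter s])"
      by (subst eq) simp
  qed (use s letter_simps(1)[of s] in \<open>auto simp: coord_simps\<close>)
qed

text \<open>\<open>Sink\<close> certifies reducibility and every other state a normal form. Branches
  into \<open>Sink\<close> use the rewriting lemmas; the others extend the last block or open a new
  one.\<close>

lemma state_inv_step:
  assumes inv: "state_inv w q" and w: "w \<in> lists S" and x: "x \<in> S"
  shows "state_inv (w @ [x]) (step q x)"
proof -
  let ?s = "sign x"
  have s: "?s \<in> {-1, 1}" by (rule sign)
  have sgn: "sgn (m + ?s) = ?s" if "sgn m \<noteq> - ?s" for m
    using that s by (auto simp: sgn_if split: if_splits)
  have snoc: "apow m @ [x] = apow (m + ?s)" if "x \<noteq> T" "sgn m \<noteq> - ?s" for m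
    using apow_snoc[OF s that(2)] letter_sign[OF x that(1)] by simp
  have cancel: "reducible (u @ apow m @ [x])" if "x \<noteq> T" "sgn m = - ?s" "u \<in> lists S" for u m
    using reducible_cancel[OF s that(2,3)] letter_sign[OF x that(1)] by simp
  show ?thesis
  proof (cases q)
    case (Pre i)
    then obtain m where m: "w = apow m" "i = sgn m" using inv by auto
    consider "x = T" | "x \<noteq> T" "sgn m = - ?s" | "x \<noteq> T" "sgn m \<noteq> - ?s" by blast
    then show ?thesis
    proof cases
      case 1
      have "state_inv (apow m @ [T]) (Mid (sgn m) 0)"
        unfolding state_inv.simps by (rule exI[of _ m], rule exI[of _ 0]) simp
      then show ?thesis using 1 m Pre by (simp del: state_inv.simps)
    next
      case 2
      then show ?thesis using m Pre cancel[of m "[]"] by simp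
    next
      case 3
      then show ?thesis using m Pre snoc[of m] sgn[of m] by (auto intro!: exI[of _ "m + ?s"])
    qed
  next
    case (Mid i j)
    then obtain m n where m: "w = apow m @ T # apow n" "i = sgn m" "j = sgn n" using inv by auto
    consider "x = T" "n = 0" | "x = T" "m \<noteq> 0" "(letter (sgn m), T) \<notin> lt"
      | "x = T" "n \<noteq> 0" "m \<noteq> 0 \<longrightarrow> (letter (sgn m), T) \<in> lt"
      | "x \<noteq> T" "sgn n = - ?s" | "x \<noteq> T" "sgn n \<noteq> - ?s" by blast
    then show ?thesis
    proof cases
      case 1
      then show ?thesis using m Mid reducible_double_T[of m] by simp
    next
      case 2
      then show ?thesis using m Mid reducible_move_left[of m n] by (simp add: sgn_0_0)
    next
      case 3
      then have "state_inv (apow m @ T # apow n @ [T]) (Post (sgn m) 0)"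
        unfolding state_inv.simps
        by - (rule exI[of _ m], rule exI[of _ n], rule exI[of _ 0], auto)
      then show ?thesis using 3 m Mid by (simp add: sgn_0_0 del: state_inv.simps)
    next
      case 4
      then show ?thesis using m Mid cancel[of n "apow m @ [T]"] by simp
    next
      case 5
      then have "state_inv (apow m @ T # apow n @ [x]) (Mid (sgn m) ?s)"
        unfolding state_inv.simps snoc[OF 5]
        using sgn by - (rule exI[of _ m], rule exI[of _ "n + ?s"], auto)
      then show ?thesis using 5 m Mid by (simp del: state_inv.simps)
    qed
  next
    case (Post i l)
    then obtain m n k where m: "w = apow m @ T # apow n @ T # apow k" "i = sgn m" "l = sgn k"
      and n: "n \<noteq> 0" and mk: "m = 0 \<or> k = 0" "m \<noteq> 0 \<longrightarrow> (letter (sgn m), T) \<in> lt"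
        "k \<noteq> 0 \<longrightarrow> (letter (sgn k), T) \<notin> lt"
      using inv by auto
    have sgn_cases: "sgn r \<noteq> - ?s \<Longrightarrow> r \<noteq> 0 \<Longrightarrow> sgn r = ?s" for r
      using s by (auto simp: sgn_if split: if_splits)
    consider "x = T" | "x \<noteq> T" "sgn k = - ?s"
      | "x \<noteq> T" "sgn k \<noteq> - ?s" "m \<noteq> 0 \<or> (x, T) \<in> lt"
      | "x \<noteq> T" "sgn k \<noteq> - ?s" "m = 0" "(x, T) \<notin> lt" by blast
    then show ?thesis
    proof cases
      case 1
      then show ?thesis using m Post reducible_three_T[of m n k] by simp
    next
      case 2
      then show ?thesis using m Post cancel[of k "apow m @ T # apow n @ [T]"] by simp
    next
      case 3
      have lx: "letter ?s = x" using letter_sign[OF x 3(1)] .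
      \<comment> \<open>Otherwise the third block consists of copies of \<open>x\<close>, so
        \<open>m = 0\<close> and \<open>x\<close> does not precede \<open>T\<close>, against the
        case assumption.\<close>
      have "k = 0"
        using 3 mk sgn_cases[of k] lx by auto
      \<comment> \<open>If a nonzero \<open>m\<close> has the sign of \<open>x\<close>, the first
        block consists of copies of \<open>x\<close>, which precedes \<open>T\<close> by the
        invariant.\<close>
      moreover have "m \<noteq> 0 \<and> sgn m = - ?s \<or> (letter ?s, T) \<in> lt"
        using 3(3) mk(2) sgn_cases[of m] lx by (cases "m = 0"; cases "sgn m = - ?s") simp_all
      ultimately show ?thesis
        using reducible_move_right[OF s, of m n] 3 m Post lx by (auto simp: sgn_0_0)
    next
      case 4
      then have "apow k @ [x] = apow (k + ?s)" "sgn (k + ?s) = ?s" "letter ?s = x"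
        using snoc sgn letter_sign[OF x] by auto
      then have "state_inv (T # apow n @ T # apow k @ [x]) (Post 0 ?s)"
        unfolding state_inv.simps using 4 n
        by - (rule exI[of _ 0], rule exI[of _ n], rule exI[of _ "k + ?s"], auto)
      then show ?thesis using 4 m Post by (simp del: state_inv.simps)
    qed
  next
    case Sink
    then show ?thesis using inv reducible_append[of w "[]" "[x]"] w x by simp
  qed
qed

lemma state_inv_run: "w \<in> lists S \<Longrightarrow> state_inv w (foldl step (Pre 0) w)"
proof (induction w rule: rev_induct)
  case Nil
  then show ?case by (auto intro: exI[of _ 0])
next
  case (snoc x w)
  then show ?case using state_inv_step[of w _ x] by simp
qed

text \<open>The third coordinate singles out \<open>Mid\<close>, and \<open>n \<noteq> 0\<close>
  separates \<open>Post\<close> from \<open>Pre\<close>. Within \<open>Post\<close>, only the sum of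
  the outer exponents is visible.\<close>

lemma state_inv_unique:
  assumes "state_inv u p" "p \<noteq> Sink" "state_inv v q" "q \<noteq> Sink" "coord u = coord v"
  shows "u = v"
proof -
  \<comment> \<open>At most one summand is nonzero, so it equals the sum; comparing its letter with
    \<open>T\<close> decides which one it is.\<close>
  have post: "m = m' \<and> k = k'"
    if "m + k = m' + k'" "m = 0 \<or> k = 0" "m' = 0 \<or> k' = 0"
      "m \<noteq> 0 \<longrightarrow> (letter (sgn m), T) \<in> lt" "k \<noteq> 0 \<longrightarrow> (letter (sgn k), T) \<notin> lt"
      "m' \<noteq> 0 \<longrightarrow> (letter (sgn m'), T) \<in> lt" "k' \<noteq> 0 \<longrightarrow> (letter (sgn k'), T) \<notin> lt"
    for m k m' k' :: int
    using that by auto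
  show ?thesis
    using assms by (cases p; cases q) (auto simp: coord_simps dest!: post)
qed

section \<open>Accepted words and shortlex representatives\<close>

lemma ex_word: "\<exists>w \<in> lists S. coord w = x"
proof -
  obtain m n e where x: "x = (m, n, e)" by (cases x)
  show ?thesis
    \<comment> \<open>For odd parity the closing \<open>T\<close> is dropped, since
      \<open>t a^n = (t a^n t) t\<close>.\<close>
    by (rule bexI[of _ "apow m @ T # apow n @ (if e then [] else [T])"])
      (auto simp: x coord_simps)
qed

text \<open>Some word represents \<open>g\<close>, so minimality applies; a smaller word with the
  same coordinates would close a cycle in a strict order.\<close>

lemma SL_properties:
  assumes "g \<in> carrier G"
  shows "SL G S lt g \<in> lists S" and "word_val G (SL G S lt g) = g"
    and "\<not> reducible (SL G S lt g)"
proof -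
  obtain w where w: "w \<in> lists S" "coord w = h g"
    using ex_word by blast
  then have "word_val G w = g"
    using inj_onD[OF inj_h] assms word_val_closed[OF w(1)] by (simp add: coord_def)
  note SL = SL_minimal[OF _ lt_lin lt_sub w(1) this]
  show 1: "SL G S lt g \<in> lists S" and 2: "word_val G (SL G S lt g) = g"
    using SL(1,2) by auto
  show "\<not> reducible (SL G S lt g)"
  proof
    assume "reducible (SL G S lt g)"
    then obtain v where v: "v \<in> lists S" "coord v = coord (SL G S lt g)"
      "(v, SL G S lt g) \<in> shortlex lt"
      by (auto simp: reducible_def)
    then have "word_val G v = g"
      using coord_eq_iff[OF v(1) 1] 2 by simp
    moreover have irr: "irrefl lt" and tr: "trans lt"
      using lt_lin by (auto simp: strict_linear_order_on_def)
    have nrefl: "(u, u) \<notin> shortlex lt" for u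
      using lexord_irrefl[OF irr] by (auto simp: shortlex_def irrefl_def)
    moreover have "(v, v) \<in> shortlex lt" if "(SL G S lt g, v) \<in> shortlex lt"
      using v(3) that lexord_trans[OF _ _ tr] by (auto simp: shortlex_def)
    ultimately show False
      using SL(3)[OF _ v(1)] v(3) by (cases "v = SL G S lt g") auto
  qed
qed

text \<open>A representative is not reducible, so its run avoids \<open>Sink\<close>. Conversely, an
  accepted word and the representative of its value are normal forms with equal coordinates, hence
  equal.\<close>

lemma SL_language_eq:
  "SL_language G S lt = {w \<in> lists S. foldl step (Pre 0) w \<noteq> Sink}"
proof (intro equalityI subsetI)
  fix w assume "w \<in> SL_language G S lt"
  then obtain g where g: "g \<in> carrier G" "w = SL G S lt g"
    by (auto simp: SL_language_def)
  then show "w \<in> {w \<in> lists S. foldl step (Pre 0) w \<noteq> Sink}"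
    using SL_properties[OF g(1)] state_inv_run[of w] by auto
next
  fix w assume "w \<in> {w \<in> lists S. foldl step (Pre 0) w \<noteq> Sink}"
  then have w: "w \<in> lists S" "foldl step (Pre 0) w \<noteq> Sink" by auto
  define v where "v = SL G S lt (word_val G w)"
  note v = SL_properties[OF word_val_closed[OF w(1)], folded v_def]
  have "foldl step (Pre 0) v \<noteq> Sink"
    using v(3) state_inv_run[OF v(1)] by auto
  moreover have "coord w = coord v"
    using v(2) by (simp add: coord_def)
  ultimately have "w = v"
    using state_inv_unique state_inv_run w v(1) by blast
  then show "w \<in> SL_language G S lt"
    using word_val_closed[OF w(1)] by (auto simp: SL_language_def v_def)
qed

text \<open>The type \<open>state\<close> is infinite, but runs from \<open>Pre 0\<close> only meet
  the signs -1, 0 and 1.\<close>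

lemma regular_SL_language: "regular_language S (SL_language G S lt)"
proof (rule regular_languageI)
  let ?D = "{-1, 0, 1 :: int}"
  let ?Q = "Pre ` ?D \<union> case_prod Mid ` (?D \<times> ?D) \<union> case_prod Post ` (?D \<times> ?D) \<union> {Sink}"
  show "finite ?Q" "Pre 0 \<in> ?Q" "?Q - {Sink} \<subseteq> ?Q" by auto
  have mem: "Pre i \<in> ?Q \<longleftrightarrow> i \<in> ?D" "Mid i j \<in> ?Q \<longleftrightarrow> i \<in> ?D \<and> j \<in> ?D"
    "Post i j \<in> ?Q \<longleftrightarrow> i \<in> ?D \<and> j \<in> ?D" "Sink \<in> ?Q" for i j
    by auto
  show step: "step q x \<in> ?Q" if "q \<in> ?Q" "x \<in> S" for q x
  proof -
    have "sign x \<in> ?D" using sign[of x] by auto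
    moreover have "0 \<in> ?D" by simp
    ultimately show ?thesis
      using that(1)
      by (cases q) (simp_all only: step.simps mem split: if_splits, simp_all only: mem simp_thms)
  qed
  have "foldl step q w \<in> ?Q" if "q \<in> ?Q" "w \<in> lists S" for q w
    using that(2,1)
  proof (induction w arbitrary: q)
    case (Cons x w)
    then show ?case using step[of q x] by (simp only: foldl_Cons)
  qed simp
  \<comment> \<open>Runs stay in \<open>?Q\<close>, so avoiding \<open>Sink\<close> means ending in
    \<open>?Q - {Sink}\<close>.\<close>
  from this[OF \<open>Pre 0 \<in> ?Q\<close>]
  show "SL_language G S lt = {w \<in> lists S. foldl step (Pre 0) w \<in> ?Q - {Sink}}"
    unfolding SL_language_eq by blast
qed

text \<open>The cone of \<open>g\<close> is the residual of the word
  \<open>SL G S lt g\<close>.\<close>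

lemma finite_SL_cones: "finite (SL_cone G S lt ` carrier G)"
proof (rule finite_subset[OF _ regular_language_finite_residuals[OF regular_SL_language]])
  show "SL_cone G S lt ` carrier G
      \<subseteq> (\<lambda>u. {w \<in> lists S. u @ w \<in> SL_language G S lt}) ` lists S"
    using SL_properties(1) by (auto simp: SL_cone_def)
qed

end


section \<open>The presented group is a copy of the wreath product\<close>

lemma (in group) int_pow_commutes:
  assumes "x \<otimes> y = y \<otimes> x" "x \<in> carrier G" "y \<in> carrier G"
  shows "x [^] (i::int) \<otimes> y = y \<otimes> x [^] i"
proof (cases i rule: int_cases2)
  case (nonneg n)
  then show ?thesis using group_commutes_pow[OF assms] by (simp add: int_pow_int)
next
  case (nonpos n)
  have "inv (x [^] n) \<otimes> y = y \<otimes> inv (x [^] n)"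
    using group_commutes_pow[OF assms] assms(2,3)
    by (metis inv_closed inv_solve_left inv_solve_right m_assoc m_closed nat_pow_closed)
  then show ?thesis using nonpos assms by (simp add: int_pow_neg_int)
qed

text \<open>Conjugation by an involution is an endomorphism and hence respects powers.\<close>

lemma (in group) involution_conj_int_pow:
  assumes t: "t \<otimes> t = \<one>" and [simp]: "t \<in> carrier G" "x \<in> carrier G"
  shows "t \<otimes> x [^] (i::int) \<otimes> t = (t \<otimes> x \<otimes> t) [^] i"
proof -
  have tt: "t \<otimes> (t \<otimes> y) = y" if "y \<in> carrier G" for y
    using that by (simp add: t flip: m_assoc)
  have "(\<lambda>y. t \<otimes> y \<otimes> t) \<in> hom G G"
    by (rule homI) (simp_all add: m_assoc tt)
  from hom_int_pow[OF this _ is_group is_group, of x i] show ?thesis by simp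
qed

lemma group_G_at: "group G_at"
  by (simp add: G_at_def group_presented_group)

lemma G_at_closed [simp]: "elt_a \<in> carrier G_at" "elt_t \<in> carrier G_at"
  by (auto simp: G_at_def elt_a_def elt_t_def pres_gen_def carrier_presented_group)

text \<open>The bracketing of the second relation shows \<open>atat = tata\<close> as commutation of
  \<open>a\<close> with \<open>tat\<close>.\<close>

lemma G_at_relations:
  "elt_t \<otimes>\<^bsub>G_at\<^esub> elt_t = \<one>\<^bsub>G_at\<^esub>"
  "elt_a \<otimes>\<^bsub>G_at\<^esub> (elt_t \<otimes>\<^bsub>G_at\<^esub> elt_a \<otimes>\<^bsub>G_at\<^esub> elt_t)
     = (elt_t \<otimes>\<^bsub>G_at\<^esub> elt_a \<otimes>\<^bsub>G_at\<^esub> elt_t) \<otimes>\<^bsub>G_at\<^esub> elt_a"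
  by (auto simp: G_at_def elt_a_def elt_t_def pres_gen_def mult_presented_group
      one_presented_group pres_class_eq_iff G_rels_def Let_def intro!: pres_eq.rel)

lemma pres_class_False_letter:
  "pres_class R [(x, False)] = inv\<^bsub>presented_group R\<^esub> pres_gen R x"
proof -
  interpret group "presented_group R" by (rule group_presented_group)
  have "pres_class R [(x, False)] \<otimes>\<^bsub>presented_group R\<^esub> pres_gen R x = \<one>\<^bsub>presented_group R\<^esub>"
    using pres_eq.cancel[of R x False]
    by (simp add: pres_gen_def mult_presented_group one_presented_group pres_class_eq_iff)
  then show ?thesis
    by (intro inv_equality[symmetric]) (auto simp: pres_gen_def carrier_presented_group)
qed

text \<open>This is the element meant to have coordinates \<open>(m, n, e)\<close> in
  \<open>wreath\<close>.\<close>

definition nf :: "int \<Rightarrow> int \<Rightarrow> bool \<Rightarrow> gen gword set" where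
  "nf m n e = elt_a [^]\<^bsub>G_at\<^esub> m \<otimes>\<^bsub>G_at\<^esub> (elt_t \<otimes>\<^bsub>G_at\<^esub> elt_a [^]\<^bsub>G_at\<^esub> n \<otimes>\<^bsub>G_at\<^esub> elt_t)
     \<otimes>\<^bsub>G_at\<^esub> (if e then elt_t else \<one>\<^bsub>G_at\<^esub>)"

text \<open>Regrouping \<open>t a^m (t a^n t)\<close> as \<open>(t a^m t) a^n t\<close> gives two
  commuting factors, whose exchange swaps the exponents, and a leftover \<open>t\<close> that flips
  the parity.\<close>

lemma nf_mult_left:
  "elt_a [^]\<^bsub>G_at\<^esub> (i::int) \<otimes>\<^bsub>G_at\<^esub> nf m n e = nf (i + m) n e"
  "elt_t \<otimes>\<^bsub>G_at\<^esub> nf m n e = nf n m (\<not> e)"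
proof -
  interpret group G_at by (rule group_G_at)
  let ?a = elt_a and ?t = elt_t
  show "?a [^]\<^bsub>G_at\<^esub> i \<otimes>\<^bsub>G_at\<^esub> nf m n e = nf (i + m) n e"
    by (simp add: nf_def int_pow_mult m_assoc)
  have tt: "?t \<otimes>\<^bsub>G_at\<^esub> (?t \<otimes>\<^bsub>G_at\<^esub> y) = y" if "y \<in> carrier G_at" for y
    using that by (simp add: G_at_relations flip: m_assoc)
  have comm: "(?t \<otimes>\<^bsub>G_at\<^esub> ?a [^]\<^bsub>G_at\<^esub> m \<otimes>\<^bsub>G_at\<^esub> ?t) \<otimes>\<^bsub>G_at\<^esub> ?a [^]\<^bsub>G_at\<^esub> n
      = ?a [^]\<^bsub>G_at\<^esub> n \<otimes>\<^bsub>G_at\<^esub> (?t \<otimes>\<^bsub>G_at\<^esub> ?a [^]\<^bsub>G_at\<^esub> m \<otimes>\<^bsub>G_at\<^esub> ?t)"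
    \<comment> \<open>The relation is lifted to powers one factor at a time, first for
      \<open>a\<close> and then for \<open>tat\<close>.\<close>
    using int_pow_commutes[OF int_pow_commutes[OF G_at_relations(2), symmetric]]
    by (simp add: involution_conj_int_pow[OF G_at_relations(1)])
  have "?t \<otimes>\<^bsub>G_at\<^esub> nf m n e = ((?t \<otimes>\<^bsub>G_at\<^esub> ?a [^]\<^bsub>G_at\<^esub> m \<otimes>\<^bsub>G_at\<^esub> ?t) \<otimes>\<^bsub>G_at\<^esub> ?a [^]\<^bsub>G_at\<^esub> n)
      \<otimes>\<^bsub>G_at\<^esub> (?t \<otimes>\<^bsub>G_at\<^esub> (if e then ?t else \<one>\<^bsub>G_at\<^esub>))"
    by (simp add: nf_def m_assoc)
  also have "\<dots> = nf n m (\<not> e)"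
    unfolding comm by (simp add: nf_def G_at_relations(1))
  finally show "?t \<otimes>\<^bsub>G_at\<^esub> nf m n e = nf n m (\<not> e)" .
qed

text \<open>Each letter or formal inverse is \<open>t\<close> or a power of \<open>a\<close>, so a
  normal form absorbs a word letter by letter from the left.\<close>

lemma ex_nf:
  assumes "g \<in> carrier G_at"
  shows "\<exists>m n e. g = nf m n e"
proof -
  interpret group G_at by (rule group_G_at)
  have inv_t: "inv\<^bsub>G_at\<^esub> elt_t = elt_t"
    using G_at_relations(1) by (intro inv_equality) auto
  have "\<exists>m n e. pres_class G_rels u = nf m n e" for u
  proof (induction u)
    case Nil
    have "pres_class G_rels [] = nf 0 0 False"
      using G_at_relations(1) by (simp add: nf_def) (simp add: G_at_def one_presented_group)
    then show ?case by blast
  next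
    case (Cons p u)
    then obtain m n e where u: "pres_class G_rels u = nf m n e" by blast
    obtain x b where p: "p = (x, b)" by (cases p)
    have "pres_class G_rels (p # u) = pres_class G_rels [p] \<otimes>\<^bsub>G_at\<^esub> nf m n e"
      by (simp add: G_at_def mult_presented_group flip: u)
    moreover have "pres_class G_rels [p] = elt_t \<or> (\<exists>i::int. pres_class G_rels [p] = elt_a [^]\<^bsub>G_at\<^esub> i)"
    proof (cases x)
      case gen_a
      have "pres_class G_rels [p] = elt_a [^]\<^bsub>G_at\<^esub> (if b then 1 else -1 :: int)"
        using pres_class_False_letter[of G_rels gen_a]
        by (simp add: p gen_a int_pow_neg) (simp add: elt_a_def pres_gen_def G_at_def)
      then show ?thesis by blast
    next
      case gen_t
      then show ?thesis
        using pres_class_False_letter[of G_rels gen_t] inv_t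
        by (cases b) (simp_all add: p elt_t_def pres_gen_def G_at_def)
    qed
    ultimately show ?case
      using nf_mult_left by metis
  qed
  then show ?thesis
    using assms by (auto simp: G_at_def carrier_presented_group)
qed

text \<open>The relations hold in \<open>wreath\<close>, so the universal property gives
  \<open>h\<close>. It is injective because it recovers the parameters of a normal form and every
  element has one.\<close>

lemma G_at_wreath:
  obtains h where "h \<in> hom G_at wreath" "inj_on h (carrier G_at)"
    "h elt_a = (1, 0, False)" "h elt_t = (0, 0, True)"
proof -
  interpret group G_at by (rule group_G_at)
  let ?f = "\<lambda>x. (case x of gen_a \<Rightarrow> (1, 0, False) | gen_t \<Rightarrow> (0, 0, True)) :: int \<times> int \<times> bool"
  have "\<exists>h \<in> hom G_at wreath. \<forall>x. h (pres_gen G_rels x) = ?f x"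
    unfolding G_at_def
    by (rule presented_group_universal[OF group_wreath]) (auto simp: G_rels_def Let_def gword_val_def)
  then obtain h where h: "h \<in> hom G_at wreath" and hx: "\<And>x. h (pres_gen G_rels x) = ?f x"
    by blast
  have ha: "h elt_a = (1, 0, False)" and ht: "h elt_t = (0, 0, True)"
    by (simp_all add: elt_a_def elt_t_def hx)
  interpret hm: group_hom G_at wreath h
    using h group_wreath by (simp add: group_hom_def group_hom_axioms_def is_group)
  have "h (nf m n e) = (m, n, e)" for m n e
    using hm.hom_one by (simp add: nf_def hm.hom_int_pow ha ht wreath_int_pow)
  then have "inj_on h (carrier G_at)"
    by (intro inj_onI) (metis ex_nf prod.inject)
  then show ?thesis
    using that h ha ht by blast
qed

theorem theorem4p4:
  fixes lt :: "(gen gword set \<times> gen gword set) set"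
  assumes "lt \<subseteq> G_alphabet \<times> G_alphabet" and "strict_linear_order_on G_alphabet lt"
  shows "regular_language G_alphabet (SL_language G_at G_alphabet lt) \<and>
         finite (SL_cone G_at G_alphabet lt ` carrier G_at)"
proof -
  obtain h where h: "h \<in> hom G_at wreath" "inj_on h (carrier G_at)"
    "h elt_a = (1, 0, False)" "h elt_t = (0, 0, True)"
    by (rule G_at_wreath)
  interpret wreath_copy G_at elt_a elt_t h lt
    using h assms group_G_at
    by (auto simp: wreath_copy_def wreath_copy_axioms_def G_alphabet_def)
  show ?thesis
    using regular_SL_language finite_SL_cones by (simp add: G_alphabet_def)
qed

end
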